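(* Let $F$ be a $\nu$-self-scaled barrier for the cone $K$, and let $x,w\in\mathrm{int}\,K$ and $s\in\mathrm{int}\,K^*$ be related by $s=\nabla^2F(w)x$ (let $y\in\mathbb R^m$ and $z=(x,y,s)$). Then for the affine-scaling direction $\Delta z=(\Delta x,\Delta y,\Delta s)$ defined by $$\Delta s+\nabla^2F(w)\Delta x=-s,\qquad A\Delta x=0,\qquad \Delta s+A^*\Delta y=0,$$ and every $\alpha\in[0,1)$ with $x+\alpha\Delta x\in\mathrm{int}\,K$ and $s+\alpha\Delta s\in\mathrm{int}\,K^*$, we have $$\begin{aligned}\xi_z(\alpha):=\Omega(z+\alpha\Delta z)-\Omega(z)&=F_*(s+\alpha\Delta s)+F_*\Big(s-\frac{\alpha}{1-\alpha}\Delta s\Big)-2F_*(s)\\&=F(x+\alpha\Delta x)+F\Big(x-\frac{\alpha}{1-\alpha}\Delta x\Big)-2F(x).\end{aligned}$$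
   Context: $\mathbb E$ is a finite-dimensional real vector space with dual space $\mathbb E^*$; $\langle s,x\rangle$ is the value of $s\in\mathbb E^*$ at $x\in\mathbb E$. $K\subset\mathbb E$ is a closed convex pointed cone with nonempty interior, $K^*=\{s\in\mathbb E^*:\langle s,x\rangle\ge0\ \forall x\in K\}$. A self-concordant function is a closed convex three times differentiable function $f$ with open domain such that $D^3f(x)[h]^3\le 2(D^2f(x)[h]^2)^{3/2}$. A $\nu$-normal (regular) barrier for $K$ is a self-concordant function $F$ with domain $\mathrm{int}\,K$, tending to $+\infty$ at the boundary, with $F(\tau x)=F(x)-\nu\ln\tau$ for $\tau>0$ ($\nu\ge1$). Its dual barrier is $F_*(s)=\max_{x\in\mathrm{int}\,K}[-\langle s,x\rangle-F(x)]$, $s\in\mathrm{int}\,K^*$. $F$ is $\nu$-self-scaled if it is a $\nu$-normal barrier and for all $x,w\in\mathrm{int}\,K$: $\nabla^2F(w)x\in\mathrm{int}\,K^*$ and $F_*(\nabla^2F(w)x)=F(x)-2F(w)-\nu$. $A:\mathbb E\to\mathbb R^m$ is a linear operator whose adjoint $A^*:\mathbb R^m\to\mathbb E^*$ is injective. The functional proximity measure is $\Omega(z)=\nu\ln\langle s,x\rangle+F(x)+F_*(s)+\nu-\nu\ln\nu$ for $z=(x,y,s)$ with $x\in\mathrm{int}\,K$, $s\in\mathrm{int}\,K^*$. *)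

theory Defs
  imports "HOL-Analysis.Analysis"
begin

text \<open>
  The space is an arbitrary type \<open>'a::euclidean_space\<close> and its dual is the type
  \<open>'a \<Rightarrow>\<^sub>L real\<close> of linear functionals (all of them bounded), so that \<open>\<langle>s, x\<rangle>\<close> is \<open>blinfun_apply s x\<close>.
  The inner product of \<open>'a\<close> is used only as a source of the canonical topology.
\<close>

definition proper_cone :: "'a::euclidean_space set \<Rightarrow> bool" where
  "proper_cone K \<longleftrightarrow>
     cone K \<and> convex K \<and> closed K \<and> K \<inter> uminus ` K = {0} \<and> interior K \<noteq> {}"

definition dual_cone :: "'a::euclidean_space set \<Rightarrow> ('a \<Rightarrow>\<^sub>L real) set" where
  "dual_cone K = {s. \<forall>x\<in>K. 0 \<le> blinfun_apply s x}"

text \<open>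
  The Frechet derivative as a bounded linear map; it can be iterated, and for real-valued
  \<open>f\<close> the second iterate at \<open>w\<close> is the Hessian as a map from the space to its dual.
  Meaningful where \<open>f\<close> is differentiable.
\<close>

definition fderiv ::
    "('a::real_normed_vector \<Rightarrow> 'b::real_normed_vector) \<Rightarrow> 'a \<Rightarrow> 'a \<Rightarrow>\<^sub>L 'b" where
  "fderiv f x = Blinfun (frechet_derivative f (at x))"

abbreviation hessian :: "('a::real_normed_vector \<Rightarrow> real) \<Rightarrow> 'a \<Rightarrow> 'a \<Rightarrow>\<^sub>L 'a \<Rightarrow>\<^sub>L real" where
  "hessian f \<equiv> fderiv (fderiv f)"

text \<open>
  A partial function with domain \<open>Q\<close> is represented by a total function whose values outside
  \<open>Q\<close> are irrelevant; it is closed if its epigraph over \<open>Q\<close> is closed.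
\<close>

definition self_concordant_on :: "'a::euclidean_space set \<Rightarrow> ('a \<Rightarrow> real) \<Rightarrow> bool" where
  "self_concordant_on Q f \<longleftrightarrow>
     open Q \<and> convex_on Q f \<and> closed {(x, t). x \<in> Q \<and> f x \<le> t} \<and>
     f differentiable_on Q \<and> fderiv f differentiable_on Q \<and>
     fderiv (fderiv f) differentiable_on Q \<and>
     (\<forall>x\<in>Q. \<forall>h. fderiv (fderiv (fderiv f)) x h h h
                   \<le> 2 * (fderiv (fderiv f) x h h) powr (3 / 2))"

definition normal_barrier :: "real \<Rightarrow> 'a::euclidean_space set \<Rightarrow> ('a \<Rightarrow> real) \<Rightarrow> bool" where
  "normal_barrier \<nu> K F \<longleftrightarrow>
     1 \<le> \<nu> \<and> self_concordant_on (interior K) F \<and>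
     (\<forall>b\<in>frontier (interior K). filterlim F at_top (at b within interior K)) \<and>
     (\<forall>x\<in>interior K. \<forall>\<tau>>0. F (\<tau> *\<^sub>R x) = F x - \<nu> * ln \<tau>)"

text \<open>The dual barrier; \<open>GREATEST\<close> expresses the maximum over the interior of \<open>K\<close>.\<close>

definition dual_barrier ::
    "'a::euclidean_space set \<Rightarrow> ('a \<Rightarrow> real) \<Rightarrow> ('a \<Rightarrow>\<^sub>L real) \<Rightarrow> real" where
  "dual_barrier K F s =
     (GREATEST v. v \<in> (\<lambda>x. - blinfun_apply s x - F x) ` interior K)"

definition self_scaled_barrier :: "real \<Rightarrow> 'a::euclidean_space set \<Rightarrow> ('a \<Rightarrow> real) \<Rightarrow> bool" where
  "self_scaled_barrier \<nu> K F \<longleftrightarrow>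
     normal_barrier \<nu> K F \<and>
     (\<forall>x\<in>interior K. \<forall>w\<in>interior K.
        hessian F w x \<in> interior (dual_cone K) \<and>
        dual_barrier K F (hessian F w x) = F x - 2 * F w - \<nu>)"

text \<open>The adjoint into the dual space: \<open>\<langle>dual_adjoint A y, x\<rangle> = y \<bullet> A x\<close>.\<close>

definition dual_adjoint ::
    "('a::euclidean_space \<Rightarrow>\<^sub>L (real ^ 'm)) \<Rightarrow> (real ^ 'm) \<Rightarrow> 'a \<Rightarrow>\<^sub>L real" where
  "dual_adjoint A y = blinfun_inner_right y o\<^sub>L A"

definition functional_proximity ::
    "real \<Rightarrow> 'a::euclidean_space set \<Rightarrow> ('a \<Rightarrow> real) \<Rightarrow>
     'a \<times> (real ^ 'm) \<times> ('a \<Rightarrow>\<^sub>L real) \<Rightarrow> real" where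
  "functional_proximity \<nu> K F = (\<lambda>(x, y, s).
     \<nu> * ln (blinfun_apply s x) + F x + dual_barrier K F s + \<nu> - \<nu> * ln \<nu>)"

definition proximity_change ::
    "real \<Rightarrow> 'a::euclidean_space set \<Rightarrow> ('a \<Rightarrow> real) \<Rightarrow>
     'a \<times> (real ^ 'm) \<times> ('a \<Rightarrow>\<^sub>L real) \<Rightarrow> 'a \<times> (real ^ 'm) \<times> ('a \<Rightarrow>\<^sub>L real) \<Rightarrow> real \<Rightarrow> real" where
  "proximity_change \<nu> K F z dz \<alpha> =
     functional_proximity \<nu> K F (z + \<alpha> *\<^sub>R dz) - functional_proximity \<nu> K F z"

end

theory Submission
  imports Defs
begin

text \<open>
  Write \<open>H\<close> for the Hessian of \<open>F\<close> at \<open>w\<close> and \<open>\<beta> = \<alpha> / (1 - \<alpha>)\<close>. Since \<open>s = H x\<close> and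
  \<open>ds = - H (x + dx)\<close>, moving the dual point along \<open>ds\<close> amounts to moving the primal
  point along \<open>dx\<close> in the opposite sense, up to a positive factor:
  \<open>s + \<alpha> ds = (1 - \<alpha>) H (x - \<beta> dx)\<close> and \<open>s - \<beta> ds = H (x + \<alpha> dx) / (1 - \<alpha>)\<close>.
  The self-scaled identity \<open>F\<^sub>* (H v) = F v - 2 F w - \<nu>\<close> and logarithmic homogeneity then give
  \<open>F\<^sub>* (s + \<alpha> ds) = F (x - \<beta> dx) - \<nu> ln (1 - \<alpha>) - 2 F w - \<nu>\<close> and
  \<open>F\<^sub>* (s - \<beta> ds) = F (x + \<alpha> dx) + \<nu> ln (1 - \<alpha>) - 2 F w - \<nu>\<close>.
  The logarithms are absorbed by the change of \<open>\<nu> ln \<langle>s, x\<rangle>\<close>: the range of the adjoint of \<open>A\<close>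
  annihilates the kernel of \<open>A\<close>, so \<open>\<langle>ds, dx\<rangle> = 0\<close>, and together with the symmetry of \<open>H\<close> this
  yields \<open>\<langle>s + \<alpha> ds, x + \<alpha> dx\<rangle> = (1 - \<alpha>) \<langle>s, x\<rangle>\<close>.

  Two ingredients need an argument. The symmetry of the second derivative
  (\<open>hessian_symmetric\<close>) is Schwarz's theorem. That \<open>x - \<beta> dx\<close> lies in the interior of \<open>K\<close>
  requires a converse of the self-scaled inclusion: if \<open>H v\<close> is interior to the dual cone, then
  \<open>v\<close> is interior to \<open>K\<close> (\<open>self_scaled_barrier_hessian_reflects_interior\<close>). Otherwise the
  segment from \<open>w\<close> to \<open>v\<close> would leave the interior at a point \<open>u\<close> where \<open>F\<close>, and
  with it \<open>F\<^sub>*\<close> composed with \<open>H\<close>, blows up; but \<open>H u\<close> is interior to the dual cone,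
  where \<open>F\<^sub>*\<close> is locally bounded above (\<open>dual_barrier_locally_bounded_above\<close>).
\<close>

section \<open>Symmetry of the Hessian\<close>

lemma has_derivative_fderiv:
  assumes "f differentiable_on S" "open S" "x \<in> S"
  shows "(f has_derivative blinfun_apply (fderiv f x)) (at x)"
proof -
  have "f differentiable (at x)"
    using assms by (simp add: differentiable_on_eq_differentiable_at)
  then have "(f has_derivative frechet_derivative f (at x)) (at x)"
    by (simp add: frechet_derivative_works)
  then show ?thesis
    by (metis fderiv_def bounded_linear_Blinfun_apply has_derivative_bounded_linear)
qed

text \<open>
  The numerator is symmetric in \<open>u\<close> and \<open>v\<close>, so this limit yields Schwarz's theorem.
  It holds because the numerator is, by the mean value theorem, \<open>t\<close> times the increment of the
  first derivative \<open>g\<close> along \<open>t v\<close>, applied to \<open>u\<close>. Linearising \<open>g\<close> around \<open>w\<close> at both end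
  points of that increment turns it into \<open>t L v\<close> with an error \<open>o(t)\<close>.
\<close>

lemma second_difference_quotient_tendsto:
  fixes f :: "'a::real_normed_vector \<Rightarrow> real" and g :: "'a \<Rightarrow> 'a \<Rightarrow>\<^sub>L real"
  assumes S: "open S" "w \<in> S"
    and f: "\<And>z. z \<in> S \<Longrightarrow> (f has_derivative blinfun_apply (g z)) (at z)"
    and g: "(g has_derivative L) (at w)"
  shows "((\<lambda>t. (f (w + t *\<^sub>R u + t *\<^sub>R v) - f (w + t *\<^sub>R u) - f (w + t *\<^sub>R v) + f w) / t\<^sup>2)
           \<longlongrightarrow> blinfun_apply (L v) u) (at_right 0)"
proof (rule tendstoI)
  fix e :: real assume "e > 0"
  define N where "N = norm u + norm v + 1"
  have N: "N > 0" "norm u \<le> N" "norm v \<le> N" "norm u + norm v \<le> N"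
    by (auto simp: N_def add_nonneg_pos)
  define \<epsilon> where "\<epsilon> = e / (4 * N\<^sup>2)"
  have "\<epsilon> > 0" using \<open>e > 0\<close> N by (simp add: \<epsilon>_def)
  then obtain d where "d > 0" and
    d: "\<And>z. norm (z - w) < d \<Longrightarrow> norm (g z - g w - L (z - w)) \<le> \<epsilon> * norm (z - w)"
    using g unfolding has_derivative_at_alt by blast
  obtain r where "r > 0" and r: "ball w r \<subseteq> S"
    using S open_contains_ball by blast
  have L: "linear L"
    using g has_derivative_linear by blast
  define T where "T = min d r / N"
  have "T > 0" using \<open>d > 0\<close> \<open>r > 0\<close> N by (simp add: T_def)
  have close: "dist ((f (w + t *\<^sub>R u + t *\<^sub>R v) - f (w + t *\<^sub>R u) - f (w + t *\<^sub>R v) + f w) / t\<^sup>2)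
      (blinfun_apply (L v) u) < e" if t: "0 < t" "t < T" for t
  proof -
    have small: "norm (p *\<^sub>R u + q *\<^sub>R v) \<le> t * N" if "0 \<le> p" "p \<le> t" "0 \<le> q" "q \<le> t" for p q
    proof -
      have "norm (p *\<^sub>R u + q *\<^sub>R v) \<le> p * norm u + q * norm v"
        using norm_triangle_ineq[of "p *\<^sub>R u" "q *\<^sub>R v"] that by simp
      also have "\<dots> \<le> t * norm u + t * norm v"
        using that by (intro add_mono mult_right_mono) auto
      also have "\<dots> = t * (norm u + norm v)" by (simp add: distrib_left)
      also have "\<dots> \<le> t * N" using t N by (intro mult_left_mono) auto
      finally show ?thesis .
    qed
    have tN: "t * N < d" "t * N < r"
      using t N by (auto simp: T_def field_simps)
    have inS: "w + p *\<^sub>R u + q *\<^sub>R v \<in> S" if "0 \<le> p" "p \<le> t" "0 \<le> q" "q \<le> t" for p q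
    proof -
      have "dist w (w + p *\<^sub>R u + q *\<^sub>R v) = norm (p *\<^sub>R u + q *\<^sub>R v)"
        by (metis add.assoc dist_add_cancel dist_0_norm add.right_neutral)
      then show ?thesis using small[OF that] tN r by auto
    qed
    \<comment> \<open>The mean value theorem is applied in the direction \<open>u\<close> to the increment of \<open>f\<close> along \<open>t v\<close>.\<close>
    define \<phi> where "\<phi> = (\<lambda>p. f (w + p *\<^sub>R u + t *\<^sub>R v) - f (w + p *\<^sub>R u + 0 *\<^sub>R v))"
    have der: "(\<phi> has_derivative
        (\<lambda>h. g (w + p *\<^sub>R u + t *\<^sub>R v) (h *\<^sub>R u) - g (w + p *\<^sub>R u + 0 *\<^sub>R v) (h *\<^sub>R u)))
        (at p within {0..t})" if "0 \<le> p" "p \<le> t" for p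
    proof -
      have "((\<lambda>p. f (w + p *\<^sub>R u + q *\<^sub>R v)) has_derivative
        (\<lambda>h. g (w + p *\<^sub>R u + q *\<^sub>R v) (h *\<^sub>R u))) (at p within {0..t})" if "0 \<le> q" "q \<le> t" for q
        by (rule has_derivative_compose[of "\<lambda>p. w + p *\<^sub>R u + q *\<^sub>R v" _ _ _ f, OF _ f[OF inS]])
          (use that \<open>0 \<le> p\<close> \<open>p \<le> t\<close> in \<open>auto intro!: derivative_eq_intros\<close>)
      from this[of t] this[of 0] show ?thesis
        unfolding \<phi>_def using t by (intro has_derivative_diff) auto
    qed
    obtain p where p: "0 < p" "p < t" and
      "\<phi> t - \<phi> 0 = g (w + p *\<^sub>R u + t *\<^sub>R v) (t *\<^sub>R u) - g (w + p *\<^sub>R u + 0 *\<^sub>R v) (t *\<^sub>R u)"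
      using mvt_simple[OF t(1) der] by auto
    then have mv: "\<phi> t - \<phi> 0 = t * (g (w + p *\<^sub>R u + t *\<^sub>R v) - g (w + p *\<^sub>R u)) u"
      by (simp add: blinfun.diff_left blinfun.scaleR_right right_diff_distrib)
    \<comment> \<open>The remainder of the linearisation of \<open>g\<close> at \<open>w\<close>; it is of order \<open>\<epsilon> t\<close>.\<close>
    define R where "R q = g (w + p *\<^sub>R u + q *\<^sub>R v) - g w - L (p *\<^sub>R u + q *\<^sub>R v)" for q
    have R: "norm (R q) \<le> \<epsilon> * (t * N)" if "0 \<le> q" "q \<le> t" for q
    proof -
      have "norm (p *\<^sub>R u + q *\<^sub>R v) \<le> t * N"
        using small that p by simp
      moreover have "norm (R q) \<le> \<epsilon> * norm (p *\<^sub>R u + q *\<^sub>R v)"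
        using d[of "w + p *\<^sub>R u + q *\<^sub>R v"] calculation tN
        by (simp add: R_def add.assoc)
      ultimately show ?thesis
        using \<open>\<epsilon> > 0\<close> by (meson less_eq_real_def mult_left_mono order_trans)
    qed
    have increment: "g (w + p *\<^sub>R u + t *\<^sub>R v) - g (w + p *\<^sub>R u) = t *\<^sub>R L v + (R t - R 0)"
      by (simp add: R_def linear_add[OF L] linear_scale[OF L])
    have *: "\<phi> t - \<phi> 0 - t\<^sup>2 * blinfun_apply (L v) u = t * (R t - R 0) u"
      unfolding mv increment
      by (simp add: blinfun.add_left blinfun.scaleR_left power2_eq_square distrib_left)
    have "norm (R t - R 0) \<le> 2 * (\<epsilon> * (t * N))"
      using norm_triangle_ineq4[of "R t" "R 0"] R[of t] R[of 0] t by simp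
    then have "norm (R t - R 0) * norm u \<le> 2 * (\<epsilon> * (t * N)) * N"
      using N t \<open>\<epsilon> > 0\<close> by (intro mult_mono) auto
    then have "\<bar>(R t - R 0) u\<bar> \<le> 2 * (\<epsilon> * (t * N)) * N"
      using norm_blinfun[of "R t - R 0" u] by simp
    also have "\<dots> = t * (e / 2)"
      using N by (simp add: \<epsilon>_def power2_eq_square)
    finally have "\<bar>\<phi> t - \<phi> 0 - t\<^sup>2 * blinfun_apply (L v) u\<bar> \<le> t * (t * (e / 2))"
      unfolding * using t by (simp add: abs_mult)
    moreover have "(\<phi> t - \<phi> 0) / t\<^sup>2 - blinfun_apply (L v) u
        = (\<phi> t - \<phi> 0 - t\<^sup>2 * blinfun_apply (L v) u) / t\<^sup>2"
      using t by (simp add: field_simps)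
    ultimately have "\<bar>(\<phi> t - \<phi> 0) / t\<^sup>2 - blinfun_apply (L v) u\<bar> \<le> e / 2"
      using t by (simp add: power2_eq_square field_simps)
    moreover have "\<phi> t - \<phi> 0
        = f (w + t *\<^sub>R u + t *\<^sub>R v) - f (w + t *\<^sub>R u) - f (w + t *\<^sub>R v) + f w"
      by (simp add: \<phi>_def)
    ultimately show ?thesis
      using \<open>e > 0\<close> by (simp add: dist_real_def)
  qed
  then show "\<forall>\<^sub>F t in at_right 0. dist ((f (w + t *\<^sub>R u + t *\<^sub>R v) - f (w + t *\<^sub>R u)
      - f (w + t *\<^sub>R v) + f w) / t\<^sup>2) (blinfun_apply (L v) u) < e"
    unfolding eventually_at_right_field using \<open>T > 0\<close> by auto
qed

lemma hessian_symmetric: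
  assumes "open S" "w \<in> S" "f differentiable_on S" "fderiv f differentiable_on S"
  shows "hessian f w u v = hessian f w v u"
proof -
  have lim: "((\<lambda>t. (f (w + t *\<^sub>R a + t *\<^sub>R b) - f (w + t *\<^sub>R a) - f (w + t *\<^sub>R b) + f w) / t\<^sup>2)
           \<longlongrightarrow> hessian f w b a) (at_right 0)" for a b
    using assms
    by (intro second_difference_quotient_tendsto[of S _ _ "fderiv f"] has_derivative_fderiv) auto
  have "((\<lambda>t. (f (w + t *\<^sub>R u + t *\<^sub>R v) - f (w + t *\<^sub>R u) - f (w + t *\<^sub>R v) + f w) / t\<^sup>2)
           \<longlongrightarrow> hessian f w u v) (at_right 0)"
    using lim[of v u] by (simp add: algebra_simps)
  from tendsto_unique[OF _ this lim[of u v]] show ?thesis by simp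
qed

section \<open>Interiors of a cone and of its dual\<close>

lemma interior_cone_scaleR:
  fixes K :: "'a::euclidean_space set"
  assumes "cone K" "x \<in> interior K" "0 < c"
  shows "c *\<^sub>R x \<in> interior K"
proof -
  have "(*\<^sub>R) c ` K \<subseteq> K"
    using assms by (auto simp: cone_def)
  then have "interior ((*\<^sub>R) c ` K) \<subseteq> interior K"
    by (rule interior_mono)
  moreover have "(*\<^sub>R) c ` interior K = interior ((*\<^sub>R) c ` K)"
    using interior_injective_linear_image[of "(*\<^sub>R) c" K] \<open>0 < c\<close>
    by (auto simp: inj_on_def)
  ultimately show ?thesis using assms by auto
qed

text \<open>
  An interior functional can be lowered by a fixed amount in every direction without becoming
  negative on the cone, so it grows at least linearly there. The constant is uniform near \<open>s\<^sub>0\<close>,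
  as the local boundedness of the dual barrier demands.
\<close>

lemma interior_dual_cone_coercive:
  fixes K :: "'a::euclidean_space set"
  assumes "s\<^sub>0 \<in> interior (dual_cone K)"
  obtains \<delta> where "\<delta> > 0"
    "\<And>s x. s \<in> ball s\<^sub>0 \<delta> \<Longrightarrow> x \<in> K \<Longrightarrow> \<delta> * norm x \<le> blinfun_apply s x"
proof -
  obtain r where "r > 0" and r: "ball s\<^sub>0 r \<subseteq> dual_cone K"
    using assms mem_interior by blast
  have "r / 2 * norm x \<le> blinfun_apply s x" if s: "s \<in> ball s\<^sub>0 (r / 2)" and x: "x \<in> K" for s x
  proof (cases "x = 0")
    case False
    \<comment> \<open>Lowering \<open>s\<close> by \<open>r / 2\<close> times the unit functional in the direction of \<open>x\<close> stays in the dual cone.\<close>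
    define l where "l = (r / (2 * norm x)) *\<^sub>R blinfun_inner_left x"
    have "norm (blinfun_inner_left x) \<le> norm x"
      by (rule norm_blinfun_bound) (auto simp: Cauchy_Schwarz_ineq2 mult.commute)
    then have "r / (2 * norm x) * norm (blinfun_inner_left x) \<le> r / (2 * norm x) * norm x"
      using \<open>r > 0\<close> by (intro mult_left_mono) auto
    then have "norm l \<le> r / (2 * norm x) * norm x"
      using \<open>r > 0\<close> by (simp add: l_def)
    then have "norm l \<le> r / 2" using False by simp
    then have "dist s\<^sub>0 (s - l) < r"
      using s norm_triangle_ineq[of "s\<^sub>0 - s" l] by (simp add: dist_norm algebra_simps)
    then have "0 \<le> blinfun_apply (s - l) x"
      using r x by (auto simp: dual_cone_def)
    then show ?thesis
      using False by (simp add: l_def blinfun.diff_left blinfun.scaleR_left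
          power2_norm_eq_inner[symmetric] power2_eq_square)
  qed (simp add: blinfun.zero_right)
  then show ?thesis using that[of "r / 2"] \<open>r > 0\<close> by auto
qed

lemma convex_dual_cone: "convex (dual_cone K)"
  by (auto simp: convex_def dual_cone_def blinfun.add_left blinfun.scaleR_left)

section \<open>Upper bounds for the dual barrier\<close>

lemma convex_on_ge_tangent:
  fixes f :: "'a::real_normed_vector \<Rightarrow> real"
  assumes f: "convex_on S f" and "e \<in> S" "z \<in> S" and f': "(f has_derivative f') (at e)"
  shows "f e + f' (z - e) \<le> f z"
proof -
  have "((\<lambda>t. f (e + t *\<^sub>R (z - e))) has_derivative (\<lambda>h. f' (h *\<^sub>R (z - e)))) (at 0)"
    by (rule has_derivative_compose[of "\<lambda>t. e + t *\<^sub>R (z - e)" _ _ _ f])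
      (use f' in \<open>auto intro!: derivative_eq_intros\<close>)
  moreover have "(\<lambda>h. f' (h *\<^sub>R (z - e))) = (*) (f' (z - e))"
    using linear_scale[OF has_derivative_linear[OF f']] by (simp add: fun_eq_iff)
  ultimately have "((\<lambda>t. f (e + t *\<^sub>R (z - e))) has_real_derivative f' (z - e)) (at 0)"
    by (simp add: has_field_derivative_def)
  then have "((\<lambda>t. (f (e + t *\<^sub>R (z - e)) - f e) / t) \<longlongrightarrow> f' (z - e)) (at 0)"
    by (simp add: DERIV_def)
  then have lim: "((\<lambda>t. (f (e + t *\<^sub>R (z - e)) - f e) / t) \<longlongrightarrow> f' (z - e)) (at_right 0)"
    by (rule filterlim_mono) (auto simp: at_within_le_at)
  have "(f (e + t *\<^sub>R (z - e)) - f e) / t \<le> f z - f e" if "0 < t" "t < 1" for t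
  proof -
    have "f ((1 - t) *\<^sub>R e + t *\<^sub>R z) \<le> (1 - t) * f e + t * f z"
      using convex_onD[OF f, of t e z] that assms by simp
    moreover have "(1 - t) *\<^sub>R e + t *\<^sub>R z = e + t *\<^sub>R (z - e)"
      by (simp add: algebra_simps)
    ultimately show ?thesis using that by (simp add: field_simps)
  qed
  then have "\<forall>\<^sub>F t in at_right 0. (f (e + t *\<^sub>R (z - e)) - f e) / t \<le> f z - f e"
    unfolding eventually_at_right_field by (intro exI[of _ 1]) auto
  from tendsto_upperbound[OF lim this] show ?thesis by simp
qed

text \<open>At the origin, logarithmic homogeneity with \<open>\<tau> = 2\<close> would force \<open>\<nu> ln 2 = 0\<close>.\<close>

lemma normal_barrier_zero_notin:
  assumes "normal_barrier \<nu> K F" "x \<in> interior K"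
  shows "x \<noteq> 0"
proof
  assume "x = 0"
  have "F (2 *\<^sub>R x) = F x - \<nu> * ln 2" and "1 \<le> \<nu>"
    using assms by (simp_all add: normal_barrier_def)
  moreover have "ln 2 > (0::real)" by simp
  ultimately show False using \<open>x = 0\<close> by simp
qed

text \<open>
  If a predicate on the reals has no greatest element, \<open>GREATEST\<close> returns one and the same value
  for all such predicates. An upper bound for the elements therefore still gives an
  upper bound for \<open>GREATEST\<close>, at the price of a universal constant.
\<close>

lemma Greatest_le_max:
  fixes P :: "real \<Rightarrow> bool"
  assumes "\<And>v. P v \<Longrightarrow> v \<le> B"
  shows "(GREATEST v. P v) \<le> max B (THE v. False)"
proof (cases "\<exists>m. P m \<and> (\<forall>v. P v \<longrightarrow> v \<le> m)")
  case True
  then obtain m where m: "P m" "\<And>v. P v \<Longrightarrow> v \<le> m" by blast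
  then have "(GREATEST v. P v) = m" by (rule Greatest_equality)
  with assms[OF m(1)] show ?thesis by (simp add: le_max_iff_disj)
next
  case False
  then have "(P m \<and> (\<forall>v. P v \<longrightarrow> v \<le> m)) = False" for m by blast
  then have "(GREATEST v. P v) = (THE v. False)"
    unfolding Greatest_def by (simp only:)
  then show ?thesis by simp
qed

text \<open>
  On the unit sphere \<open>F\<close> is bounded below by its tangent at any interior point \<open>e\<close>, and
  homogeneity gives \<open>F (\<tau> z) \<ge> - C - \<nu> ln \<tau>\<close> for unit vectors \<open>z\<close>. The coercive term
  \<open>\<langle>s, \<tau> z\<rangle> \<ge> \<delta> \<tau>\<close> dominates the logarithm, uniformly for \<open>s\<close> near \<open>s\<^sub>0\<close>.
  This bounds the values whose maximum defines the dual barrier, and \<open>Greatest_le_max\<close> carries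
  the bound over to \<open>GREATEST\<close>.
\<close>

lemma dual_barrier_locally_bounded_above:
  fixes K :: "'a::euclidean_space set"
  assumes "cone K" and F: "normal_barrier \<nu> K F" and "s\<^sub>0 \<in> interior (dual_cone K)"
  obtains \<delta> B where "\<delta> > 0" "\<And>s. s \<in> ball s\<^sub>0 \<delta> \<Longrightarrow> dual_barrier K F s \<le> B"
proof -
  obtain \<delta> where "\<delta> > 0" and
    \<delta>: "\<And>s x. s \<in> ball s\<^sub>0 \<delta> \<Longrightarrow> x \<in> K \<Longrightarrow> \<delta> * norm x \<le> blinfun_apply s x"
    using interior_dual_cone_coercive assms(3) by blast
  have \<nu>: "1 \<le> \<nu>" and sc: "self_concordant_on (interior K) F"
    and hom: "\<And>x \<tau>. x \<in> interior K \<Longrightarrow> \<tau> > 0 \<Longrightarrow> F (\<tau> *\<^sub>R x) = F x - \<nu> * ln \<tau>"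
    using F by (auto simp: normal_barrier_def)
  obtain C where C: "\<And>z. z \<in> interior K \<Longrightarrow> norm z = 1 \<Longrightarrow> - C \<le> F z"
  proof (cases "interior K = {}")
    case False
    then obtain e where e: "e \<in> interior K" by blast
    have cv: "convex_on (interior K) F" and df: "F differentiable_on interior K"
      using sc by (auto simp: self_concordant_on_def)
    have "- (norm (fderiv F e) * (1 + norm e) - F e) \<le> F z"
      if z: "z \<in> interior K" "norm z = 1" for z
    proof -
      have "F e + fderiv F e (z - e) \<le> F z"
        using convex_on_ge_tangent[OF cv e z(1) has_derivative_fderiv[OF df open_interior e]] .
      moreover have "\<bar>fderiv F e (z - e)\<bar> \<le> norm (fderiv F e) * norm (z - e)"
        using norm_blinfun[of "fderiv F e" "z - e"] by simp
      moreover have "norm (fderiv F e) * norm (z - e) \<le> norm (fderiv F e) * (1 + norm e)"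
        using norm_triangle_ineq4[of z e] z by (intro mult_left_mono) auto
      ultimately show ?thesis by simp
    qed
    then show ?thesis using that by blast
  qed auto
  have "- blinfun_apply s x - F x \<le> C + \<nu> * ln (\<nu> / \<delta>) - \<nu>"
    if s: "s \<in> ball s\<^sub>0 \<delta>" and x: "x \<in> interior K" for s x
  proof -
    define \<tau> where "\<tau> = norm x"
    have "\<tau> > 0" using normal_barrier_zero_notin[OF F x] by (simp add: \<tau>_def)
    define z where "z = (1 / \<tau>) *\<^sub>R x"
    have z: "z \<in> interior K"
      unfolding z_def using interior_cone_scaleR[OF \<open>cone K\<close> x] \<open>\<tau> > 0\<close> by simp
    have "norm z = 1" using \<open>\<tau> > 0\<close> by (simp add: z_def \<tau>_def[symmetric])
    have "F x = F z - \<nu> * ln \<tau>"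
      using hom[OF z \<open>\<tau> > 0\<close>] \<open>\<tau> > 0\<close> by (simp add: z_def)
    moreover have "\<delta> * \<tau> \<le> blinfun_apply s x"
      unfolding \<tau>_def using \<delta> s x interior_subset by blast
    \<comment> \<open>\<open>\<nu> ln \<tau> - \<delta> \<tau>\<close> is largest at \<open>\<tau> = \<nu> / \<delta>\<close>.\<close>
    moreover have "\<nu> * ln \<tau> - \<delta> * \<tau> \<le> \<nu> * ln (\<nu> / \<delta>) - \<nu>"
    proof -
      have "ln (\<tau> / (\<nu> / \<delta>)) \<le> \<tau> / (\<nu> / \<delta>) - 1"
        using \<open>\<tau> > 0\<close> \<open>\<delta> > 0\<close> \<nu> by (intro ln_le_minus_one) auto
      then have "ln \<tau> - ln (\<nu> / \<delta>) \<le> \<delta> * \<tau> / \<nu> - 1"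
        using \<open>\<tau> > 0\<close> \<open>\<delta> > 0\<close> \<nu> by (subst (asm) ln_div) (auto simp: mult.commute)
      then have "\<nu> * (ln \<tau> - ln (\<nu> / \<delta>)) \<le> \<nu> * (\<delta> * \<tau> / \<nu> - 1)"
        using \<nu> by (intro mult_left_mono) auto
      then show ?thesis using \<nu> by (simp add: right_diff_distrib)
    qed
    ultimately show ?thesis using C[OF z \<open>norm z = 1\<close>] by simp
  qed
  then have "dual_barrier K F s \<le> max (C + \<nu> * ln (\<nu> / \<delta>) - \<nu>) (THE v. False)"
    if "s \<in> ball s\<^sub>0 \<delta>" for s
    unfolding dual_barrier_def using that by (intro Greatest_le_max) auto
  then show ?thesis using that \<open>\<delta> > 0\<close> by blast
qed

section \<open>Scaling by the Hessian of a self-scaled barrier\<close>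

text \<open>
  Only the forward inclusion, of \<open>H (interior K)\<close> in the interior of the dual cone, is part of
  self-scaledness. The converse is a barrier argument: \<open>F\<close> cannot blow up at a
  point \<open>u\<close> for which \<open>H u\<close> is interior to the dual cone.
\<close>

lemma self_scaled_barrier_hessian_reflects_interior:
  fixes K :: "'a::euclidean_space set"
  assumes K: "proper_cone K" and F: "self_scaled_barrier \<nu> K F" and w: "w \<in> interior K"
    and v: "hessian F w v \<in> interior (dual_cone K)"
  shows "v \<in> interior K"
proof (rule ccontr)
  assume "v \<notin> interior K"
  have cone: "cone K"
    using K by (simp add: proper_cone_def)
  have normal: "normal_barrier \<nu> K F"
    and ss: "\<And>x. x \<in> interior K \<Longrightarrow> hessian F w x \<in> interior (dual_cone K)"
      "\<And>x. x \<in> interior K \<Longrightarrow> dual_barrier K F (hessian F w x) = F x - 2 * F w - \<nu>"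
    using F w by (auto simp: self_scaled_barrier_def)
  obtain u where u: "u \<in> closed_segment w v" "u \<in> frontier (interior K)"
    using connected_Int_frontier[of "closed_segment w v" "interior K"] w \<open>v \<notin> interior K\<close> by auto
  obtain t where "0 \<le> t" "t \<le> 1" and t: "u = (1 - t) *\<^sub>R w + t *\<^sub>R v"
    using u(1) by (auto simp: closed_segment_def)
  have "hessian F w u = (1 - t) *\<^sub>R hessian F w w + t *\<^sub>R hessian F w v"
    by (simp add: t blinfun.add_right blinfun.scaleR_right)
  then have "hessian F w u \<in> interior (dual_cone K)"
    using convexD_alt[OF convex_interior[OF convex_dual_cone] ss(1)[OF w] v] \<open>0 \<le> t\<close> \<open>t \<le> 1\<close>
    by simp
  then obtain \<delta> B where "\<delta> > 0" and
    B: "\<And>s. s \<in> ball (hessian F w u) \<delta> \<Longrightarrow> dual_barrier K F s \<le> B"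
    using dual_barrier_locally_bounded_above[OF cone normal] by blast
  have "((\<lambda>z. hessian F w z) \<longlongrightarrow> hessian F w u) (at u within interior K)"
    by (intro tendsto_intros)
  then have "\<forall>\<^sub>F z in at u within interior K. dist (hessian F w z) (hessian F w u) < \<delta>"
    using \<open>\<delta> > 0\<close> by (rule tendstoD)
  moreover have "\<forall>\<^sub>F z in at u within interior K. B + 2 * F w + \<nu> < F z"
    using normal u(2) filterlim_at_top_dense by (auto simp: normal_barrier_def)
  moreover have "\<forall>\<^sub>F z in at u within interior K. z \<in> interior K"
    by (simp add: eventually_at_filter)
  ultimately have "\<forall>\<^sub>F z in at u within interior K. False"
  proof eventually_elim
    case (elim z)
    then have "F z - 2 * F w - \<nu> \<le> B"
      using B[of "hessian F w z"] ss(2) by (simp add: dist_commute)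
    with elim show ?case by simp
  qed
  then have "\<not> u islimpt interior K"
    using trivial_limit_within[of u "interior K"] by (simp add: eventually_False)
  then show False
    using u(2) by (auto simp: frontier_def closure_def)
qed

section \<open>Change of the proximity measure along the affine-scaling direction\<close>

theorem lemma14:
  fixes K :: "'a::euclidean_space set" and F :: "'a \<Rightarrow> real" and \<nu> \<alpha> :: real
    and A :: "'a \<Rightarrow>\<^sub>L (real ^ 'm)"
    and x w dx :: 'a and y dy :: "real ^ 'm" and s ds :: "'a \<Rightarrow>\<^sub>L real"
  assumes "proper_cone K" and "self_scaled_barrier \<nu> K F"
    and "inj (dual_adjoint A)"
    and "x \<in> interior K" and "w \<in> interior K" and "s \<in> interior (dual_cone K)"
    and "s = hessian F w x"
    and "ds + hessian F w dx = - s" and "A dx = 0" and "ds + dual_adjoint A dy = 0"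
    and "0 \<le> \<alpha>" and "\<alpha> < 1"
    and "x + \<alpha> *\<^sub>R dx \<in> interior K" and "s + \<alpha> *\<^sub>R ds \<in> interior (dual_cone K)"
  shows "s - (\<alpha> / (1 - \<alpha>)) *\<^sub>R ds \<in> interior (dual_cone K) \<and>
    x - (\<alpha> / (1 - \<alpha>)) *\<^sub>R dx \<in> interior K \<and>
    proximity_change \<nu> K F (x, y, s) (dx, dy, ds) \<alpha> =
      dual_barrier K F (s + \<alpha> *\<^sub>R ds) + dual_barrier K F (s - (\<alpha> / (1 - \<alpha>)) *\<^sub>R ds)
        - 2 * dual_barrier K F s \<and>
    proximity_change \<nu> K F (x, y, s) (dx, dy, ds) \<alpha> =
      F (x + \<alpha> *\<^sub>R dx) + F (x - (\<alpha> / (1 - \<alpha>)) *\<^sub>R dx) - 2 * F x"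
proof -
  define H where "H = hessian F w"
  define \<beta> where "\<beta> = \<alpha> / (1 - \<alpha>)"
  have \<beta>: "(1 - \<alpha>) * \<beta> = \<alpha>" "1 + \<beta> = 1 / (1 - \<alpha>)"
    using \<open>\<alpha> < 1\<close> by (auto simp: \<beta>_def field_simps)
  have cone: "cone K" using assms(1) by (simp add: proper_cone_def)
  have normal: "normal_barrier \<nu> K F"
    and ss: "\<And>x. x \<in> interior K \<Longrightarrow> H x \<in> interior (dual_cone K)"
      "\<And>x. x \<in> interior K \<Longrightarrow> dual_barrier K F (H x) = F x - 2 * F w - \<nu>"
    using assms(2,5) by (auto simp: self_scaled_barrier_def H_def)
  have hom: "F (\<tau> *\<^sub>R x) = F x - \<nu> * ln \<tau>" if "x \<in> interior K" "\<tau> > 0" for x \<tau>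
    using normal that by (simp add: normal_barrier_def)
  have s: "s = H x" and ds: "ds = - (H x + H dx)"
    using assms(7,8) by (auto simp: H_def eq_diff_eq)
  have s_minus: "s - \<beta> *\<^sub>R ds = H ((1 / (1 - \<alpha>)) *\<^sub>R (x + \<alpha> *\<^sub>R dx))"
  proof -
    have "s - \<beta> *\<^sub>R ds = (1 + \<beta>) *\<^sub>R H x + \<beta> *\<^sub>R H dx"
      by (simp add: s ds algebra_simps)
    also have "\<dots> = (1 / (1 - \<alpha>)) *\<^sub>R (H x + \<alpha> *\<^sub>R H dx)"
      unfolding \<beta>(2) by (simp add: \<beta>_def scaleR_add_right)
    finally show ?thesis by (simp add: blinfun.add_right blinfun.scaleR_right)
  qed
  have s_plus: "s + \<alpha> *\<^sub>R ds = H ((1 - \<alpha>) *\<^sub>R (x - \<beta> *\<^sub>R dx))"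
  proof -
    have "(1 - \<alpha>) *\<^sub>R (x - \<beta> *\<^sub>R dx) = (1 - \<alpha>) *\<^sub>R x - \<alpha> *\<^sub>R dx"
      by (simp add: scaleR_diff_right \<beta>(1))
    then have "H ((1 - \<alpha>) *\<^sub>R (x - \<beta> *\<^sub>R dx)) = (1 - \<alpha>) *\<^sub>R H x - \<alpha> *\<^sub>R H dx"
      by (simp only: blinfun.diff_right blinfun.scaleR_right)
    moreover have "s + \<alpha> *\<^sub>R ds = (1 - \<alpha>) *\<^sub>R H x - \<alpha> *\<^sub>R H dx"
      by (simp add: s ds scaleR_left_diff_distrib scaleR_right_diff_distrib)
    ultimately show ?thesis by simp
  qed
  have xplus: "(1 / (1 - \<alpha>)) *\<^sub>R (x + \<alpha> *\<^sub>R dx) \<in> interior K"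
    using interior_cone_scaleR[OF cone assms(13)] \<open>\<alpha> < 1\<close> by simp
  have scaled: "(1 - \<alpha>) *\<^sub>R (x - \<beta> *\<^sub>R dx) \<in> interior K"
    using self_scaled_barrier_hessian_reflects_interior[OF assms(1,2,5)] assms(14) s_plus
    by (simp add: H_def)
  then have "(1 / (1 - \<alpha>)) *\<^sub>R ((1 - \<alpha>) *\<^sub>R (x - \<beta> *\<^sub>R dx)) \<in> interior K"
    by (rule interior_cone_scaleR[OF cone]) (use \<open>\<alpha> < 1\<close> in simp)
  then have xminus: "x - \<beta> *\<^sub>R dx \<in> interior K"
    using \<open>\<alpha> < 1\<close> by simp
  have sminus: "s - \<beta> *\<^sub>R ds \<in> interior (dual_cone K)"
    unfolding s_minus using ss(1) xplus by blast
  have Fs: "dual_barrier K F s = F x - 2 * F w - \<nu>"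
    using ss(2) assms(4) s by simp
  have Fsminus: "dual_barrier K F (s - \<beta> *\<^sub>R ds)
      = F (x + \<alpha> *\<^sub>R dx) + \<nu> * ln (1 - \<alpha>) - 2 * F w - \<nu>"
    unfolding s_minus ss(2)[OF xplus] using hom[OF assms(13), of "1 / (1 - \<alpha>)"] \<open>\<alpha> < 1\<close>
    by (simp add: ln_div)
  have Fsplus: "dual_barrier K F (s + \<alpha> *\<^sub>R ds)
      = F (x - \<beta> *\<^sub>R dx) - \<nu> * ln (1 - \<alpha>) - 2 * F w - \<nu>"
    unfolding s_plus ss(2)[OF scaled] using hom[OF xminus, of "1 - \<alpha>"] \<open>\<alpha> < 1\<close> by simp
  \<comment> \<open>The pairing is linear in \<open>\<alpha>\<close> as \<open>\<langle>ds, dx\<rangle> = 0\<close>; symmetry of the Hessian gives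
     \<open>\<langle>s, dx\<rangle> + \<langle>ds, x\<rangle> = - \<langle>s, x\<rangle>\<close>.\<close>
  have pairing: "blinfun_apply (s + \<alpha> *\<^sub>R ds) (x + \<alpha> *\<^sub>R dx) = (1 - \<alpha>) * blinfun_apply s x"
  proof -
    have "blinfun_apply (ds + dual_adjoint A dy) dx = 0" using assms(10) by simp
    then have "blinfun_apply ds dx = 0"
      using assms(9) by (simp add: blinfun.add_left dual_adjoint_def)
    moreover have "blinfun_apply (H dx) x = blinfun_apply (H x) dx"
      unfolding H_def using normal assms(5)
      by (intro hessian_symmetric[of "interior K"])
        (auto simp: normal_barrier_def self_concordant_on_def)
    then have "blinfun_apply s dx + blinfun_apply ds x = - blinfun_apply s x"
      by (simp add: s ds blinfun.minus_left blinfun.diff_left)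
    then have "\<alpha> * blinfun_apply s dx + \<alpha> * blinfun_apply ds x = - \<alpha> * blinfun_apply s x"
      by (simp flip: distrib_left)
    ultimately show ?thesis
      by (simp add: blinfun.add_left blinfun.add_right blinfun.scaleR_left blinfun.scaleR_right
          algebra_simps)
  qed
  have "blinfun_apply s x > 0"
  proof -
    obtain \<delta> where "\<delta> > 0" and
      "\<And>s' z. s' \<in> ball s \<delta> \<Longrightarrow> z \<in> K \<Longrightarrow> \<delta> * norm z \<le> blinfun_apply s' z"
      using interior_dual_cone_coercive assms(6) by blast
    then have "\<delta> * norm x \<le> blinfun_apply s x"
      using assms(4) interior_subset by force
    moreover have "0 < \<delta> * norm x"
      using \<open>\<delta> > 0\<close> normal_barrier_zero_notin[OF normal assms(4)] by simp
    ultimately show ?thesis by linarith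
  qed
  then have ln_pairing: "ln (blinfun_apply (s + \<alpha> *\<^sub>R ds) (x + \<alpha> *\<^sub>R dx))
      = ln (1 - \<alpha>) + ln (blinfun_apply s x)"
    unfolding pairing using \<open>\<alpha> < 1\<close> by (simp add: ln_mult)
  have change: "proximity_change \<nu> K F (x, y, s) (dx, dy, ds) \<alpha>
      = \<nu> * ln (1 - \<alpha>) + F (x + \<alpha> *\<^sub>R dx) + dual_barrier K F (s + \<alpha> *\<^sub>R ds)
        - F x - dual_barrier K F s"
    by (simp add: proximity_change_def functional_proximity_def ln_pairing distrib_left)
  show ?thesis
    unfolding \<beta>_def[symmetric]
    using sminus xminus change Fs Fsplus Fsminus by simp
qed

end
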